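(* Let $E$ be a linear relation on $\mathcal{H}$. Then the following are equivalent: (i) $E$ is sub-idempotent, i.e. $E^2 \subseteq E$; (ii) $E = P_{\operatorname{ran} E,\, \operatorname{ran}(I-E)} \cap (\operatorname{dom} E \times \mathcal{H})$; (iii) $\ker(I-E) = \operatorname{ran} E \cap \operatorname{dom} E$; (iv) $P_{\operatorname{ran} E \cap \operatorname{dom} E,\, \ker E} \subseteq E$. In this case, $\operatorname{mul} E \cap \operatorname{dom} E = \operatorname{ran} E \cap \ker E$.
   Context: $\mathcal{H}$ is a complex separable Hilbert space; "subspace" means linear subspace, not necessarily closed. A linear relation on $\mathcal{H}$ is a linear subspace $E \subseteq \mathcal{H}\times\mathcal{H}$, with $\operatorname{dom}E=\{x:(x,y)\in E \text{ for some } y\}$, $\operatorname{ran}E=\{y:(x,y)\in E\text{ for some }x\}$, $\ker E=\{x:(x,0)\in E\}$, $\operatorname{mul}E=\{y:(0,y)\in E\}$. Product: $ST=\{(x,y): (x,z)\in T,\ (z,y)\in S \text{ for some } z\}$, and $E^2=EE$. $I=\{(u,u):u\in\mathcal{H}\}$ and $I-E=\{(x,x-y):(x,y)\in E\}$. For subspaces $\mathcal{M},\mathcal{N}$ of $\mathcal{H}$, $P_{\mathcal{M},\mathcal{N}}:=\{(m+n,m): m\in\mathcal{M},\ n\in\mathcal{N}\}$ (a linear relation). Inclusions and intersections of relations are as subsets of $\mathcal{H}\times\mathcal{H}$. *)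

theory Defs
  imports "HOL-Analysis.Analysis"
begin

class complex_vector = ab_group_add +
  fixes scaleC :: "complex \<Rightarrow> 'a \<Rightarrow> 'a" (infixr "*\<^sub>C" 75)
  assumes scaleC_add_right: "a *\<^sub>C (x + y) = a *\<^sub>C x + a *\<^sub>C y"
    and scaleC_add_left: "(a + b) *\<^sub>C x = a *\<^sub>C x + b *\<^sub>C x"
    and scaleC_scaleC: "a *\<^sub>C b *\<^sub>C x = (a * b) *\<^sub>C x"
    and scaleC_one: "1 *\<^sub>C x = x"

global_interpretation complex_vector: vector_space "scaleC :: complex \<Rightarrow> 'a \<Rightarrow> 'a :: complex_vector"
  defines csubspace = complex_vector.subspace
  by unfold_locales (fact scaleC_add_right scaleC_add_left scaleC_scaleC scaleC_one)+

instantiation prod :: (complex_vector, complex_vector) complex_vector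
begin

definition scaleC_prod_def: "c *\<^sub>C p = (c *\<^sub>C fst p, c *\<^sub>C snd p)"

instance
  by standard
    (simp_all add: scaleC_prod_def scaleC_add_right scaleC_add_left scaleC_scaleC scaleC_one)

end

text \<open>
  A complex Hilbert space is modelled as a complete real inner product space (with the library's
  norm and topology) carrying a complex scalar multiplication that extends the real one, and a
  sesquilinear form, linear in the first argument, whose real part is the real inner product.
  Positive definiteness of the form and \<open>(norm x)^2 = cinner x x\<close> follow from these axioms.
\<close>

class complex_hilbert_space = complex_vector + real_inner + complete_space +
  fixes cinner :: "'a \<Rightarrow> 'a \<Rightarrow> complex"
  assumes scaleC_of_real: "complex_of_real r *\<^sub>C x = r *\<^sub>R x"
    and cinner_commute: "cinner x y = cnj (cinner y x)"
    and cinner_add_left: "cinner (x + y) z = cinner x z + cinner y z"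
    and cinner_scaleC_left: "cinner (c *\<^sub>C x) y = c * cinner x y"
    and inner_eq_Re_cinner: "inner x y = Re (cinner x y)"

lemma (in complex_hilbert_space) cinner_self: "cinner x x = complex_of_real ((norm x)\<^sup>2)"
proof -
  have "Im (cinner x x) = 0"
    using arg_cong[OF cinner_commute[of x x], of Im] by simp
  moreover have "Re (cinner x x) = (norm x)\<^sup>2"
    by (simp add: norm_eq_sqrt_inner inner_eq_Re_cinner[symmetric])
  ultimately show ?thesis by (simp add: complex_eq_iff)
qed

instantiation complex :: complex_hilbert_space
begin

definition scaleC_complex_def: "(c :: complex) *\<^sub>C (x :: complex) = c * x"

definition cinner_complex_def: "cinner (x :: complex) y = x * cnj y"

instance
  by standard
    (simp_all add: scaleC_complex_def cinner_complex_def inner_complex_def scaleR_conv_of_real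
      algebra_simps)

end

definition linear_relation :: "('h::complex_vector \<times> 'h) set \<Rightarrow> bool"
  where "linear_relation E \<longleftrightarrow> csubspace E"

text \<open>
  The domain and the range of a relation are \<^const>\<open>Domain\<close> and \<^const>\<open>Range\<close>. Relational
  composition \<^const>\<open>relcomp\<close> is diagrammatic, so the operator-style product \<open>ST\<close> is \<open>T O S\<close>.
\<close>

definition rel_ker :: "('h::complex_vector \<times> 'h) set \<Rightarrow> 'h set"
  where "rel_ker E = {x. (x, 0) \<in> E}"

definition rel_mul :: "('h::complex_vector \<times> 'h) set \<Rightarrow> 'h set"
  where "rel_mul E = {y. (0, y) \<in> E}"

definition id_minus :: "('h::complex_vector \<times> 'h) set \<Rightarrow> ('h \<times> 'h) set"
  where "id_minus E = {(x, x - y) | x y. (x, y) \<in> E}"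

definition rel_P :: "'h::complex_vector set \<Rightarrow> 'h set \<Rightarrow> ('h \<times> 'h) set"
  where "rel_P M N = {(m + n, m) | m n. m \<in> M \<and> n \<in> N}"

definition sub_idempotent :: "('h::complex_vector \<times> 'h) set \<Rightarrow> bool"
  where "sub_idempotent E \<longleftrightarrow> E O E \<subseteq> E"

end

theory Submission
  imports Defs
begin

text \<open>
  Every condition is compared with the pointwise form of (iii): \<open>(x, x) \<in> E\<close> for all \<open>x\<close> in
  \<open>ran E \<inter> dom E\<close>. The key step is for (ii): if \<open>m \<in> ran E\<close>, \<open>(u, v) \<in> E\<close> and
  \<open>m + (u - v) \<in> dom E\<close>, then \<open>m - v \<in> ran E \<inter> dom E\<close>, and
  \<open>(m + (u - v), m) = (m - v, m - v) + (u, v)\<close> lies in \<open>E\<close>.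
\<close>

lemma linear_relation_zero: "linear_relation E \<Longrightarrow> (0, 0) \<in> E"
  unfolding linear_relation_def using complex_vector.subspace_0[of E]
  by (simp add: zero_prod_def)

lemma linear_relation_add:
  "linear_relation E \<Longrightarrow> (a, b) \<in> E \<Longrightarrow> (c, d) \<in> E \<Longrightarrow> (a + c, b + d) \<in> E"
  unfolding linear_relation_def using complex_vector.subspace_add[of E "(a, b)" "(c, d)"] by simp

lemma linear_relation_diff:
  "linear_relation E \<Longrightarrow> (a, b) \<in> E \<Longrightarrow> (c, d) \<in> E \<Longrightarrow> (a - c, b - d) \<in> E"
  unfolding linear_relation_def using complex_vector.subspace_diff[of E "(a, b)" "(c, d)"] by simp

lemma rel_ker_id_minus: "rel_ker (id_minus E) = {x. (x, x) \<in> E}"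
  by (auto simp: rel_ker_def id_minus_def)

text \<open>Two composable pairs, their composite and the diagonal pair at the middle point are
  linearly dependent: \<open>(u, x) + (x, w) = (u, w) + (x, x)\<close>. Hence the composite lies in
  \<open>E\<close> exactly when the diagonal pair does.\<close>

lemma sub_idempotent_iff_refl_on_Range_Int_Domain:
  assumes E: "linear_relation E"
  shows "sub_idempotent E \<longleftrightarrow> (\<forall>x \<in> Range E \<inter> Domain E. (x, x) \<in> E)"
proof
  assume si: "sub_idempotent E"
  show "\<forall>x \<in> Range E \<inter> Domain E. (x, x) \<in> E"
  proof
    fix x assume "x \<in> Range E \<inter> Domain E"
    then obtain u w where ux: "(u, x) \<in> E" and xw: "(x, w) \<in> E" by blast
    then have "(u, w) \<in> E" using si by (auto simp: sub_idempotent_def)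
    \<comment> \<open>The pair formed is \<open>(x, w) + ((u, x) - (u, w))\<close>, which cancels to
      \<open>(x, x)\<close>.\<close>
    from linear_relation_add[OF E xw linear_relation_diff[OF E ux this]]
    show "(x, x) \<in> E" by simp
  qed
next
  assume refl: "\<forall>x \<in> Range E \<inter> Domain E. (x, x) \<in> E"
  have "(x, y) \<in> E" if xz: "(x, z) \<in> E" and zy: "(z, y) \<in> E" for x y z
  proof -
    have "(z, z) \<in> E" using refl xz zy by blast
    \<comment> \<open>Here \<open>(x, z) + ((z, y) - (z, z))\<close> cancels to
      \<open>(x, y)\<close>.\<close>
    from linear_relation_add[OF E xz linear_relation_diff[OF E zy this]]
    show ?thesis by simp
  qed
  then show "sub_idempotent E" by (auto simp: sub_idempotent_def)
qed

lemma eq_rel_P_iff_refl_on_Range_Int_Domain: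
  assumes E: "linear_relation E"
  shows "E = rel_P (Range E) (Range (id_minus E)) \<inter> (Domain E \<times> UNIV) \<longleftrightarrow>
    (\<forall>x \<in> Range E \<inter> Domain E. (x, x) \<in> E)" (is "E = ?P \<longleftrightarrow> _")
proof
  assume eq: "E = ?P"
  \<comment> \<open>With \<open>n = 0\<close> allowed, the splitting \<open>x = x + 0\<close>
    exhibits \<open>(x, x)\<close> as an element of \<open>rel_P\<close>.\<close>
  have "0 \<in> Range (id_minus E)"
    using linear_relation_zero[OF E] by (force simp: id_minus_def)
  then have "(x, x) \<in> ?P" if "x \<in> Range E \<inter> Domain E" for x
    using that by (force simp: rel_P_def)
  then show "\<forall>x \<in> Range E \<inter> Domain E. (x, x) \<in> E" using eq by blast
next
  assume refl: "\<forall>x \<in> Range E \<inter> Domain E. (x, x) \<in> E"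
  show "E = ?P"
  proof
    show "E \<subseteq> ?P"
    proof clarify
      fix x y assume xy: "(x, y) \<in> E"
      then have "x - y \<in> Range (id_minus E)" "y \<in> Range E" by (auto simp: id_minus_def)
      moreover have "(x, y) = (y + (x - y), y)" by simp
      ultimately have "(x, y) \<in> rel_P (Range E) (Range (id_minus E))"
        unfolding rel_P_def by blast
      with xy show "(x, y) \<in> ?P" by blast
    qed
    show "?P \<subseteq> E"
    proof
      fix p assume "p \<in> ?P"
      then obtain m u v a b where p: "p = (m + (u - v), m)"
        and am: "(a, m) \<in> E" and uv: "(u, v) \<in> E" and b: "(m + (u - v), b) \<in> E"
        by (auto simp: rel_P_def id_minus_def)
      \<comment> \<open>Subtracting \<open>(u, v)\<close> from the pair starting at
        \<open>m + (u - v)\<close> puts \<open>m - v\<close> in the domain; subtracting it from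
        \<open>(a, m)\<close> puts \<open>m - v\<close> in the range.\<close>
      have "(m - v, b - v) \<in> E" using linear_relation_diff[OF E b uv] by simp
      moreover have "(a - u, m - v) \<in> E" using linear_relation_diff[OF E am uv] .
      ultimately have "(m - v, m - v) \<in> E" using refl by blast
      from linear_relation_add[OF E this uv] show "p \<in> E"
        unfolding p by (simp add: algebra_simps)
    qed
  qed
qed

text \<open>The diagonal pairs are the case \<open>n = 0\<close>, and they generate the rest through
  \<open>(m + n, m) = (m, m) + (n, 0)\<close>.\<close>

lemma rel_P_subset_iff_refl_on_Range_Int_Domain:
  assumes E: "linear_relation E"
  shows "rel_P (Range E \<inter> Domain E) (rel_ker E) \<subseteq> E \<longleftrightarrow>
    (\<forall>x \<in> Range E \<inter> Domain E. (x, x) \<in> E)"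
proof
  assume sub: "rel_P (Range E \<inter> Domain E) (rel_ker E) \<subseteq> E"
  have "0 \<in> rel_ker E" using linear_relation_zero[OF E] by (simp add: rel_ker_def)
  then have "(x, x) \<in> rel_P (Range E \<inter> Domain E) (rel_ker E)" if "x \<in> Range E \<inter> Domain E" for x
    using that by (force simp: rel_P_def)
  then show "\<forall>x \<in> Range E \<inter> Domain E. (x, x) \<in> E" using sub by blast
next
  assume refl: "\<forall>x \<in> Range E \<inter> Domain E. (x, x) \<in> E"
  have "(m + n, m) \<in> E" if "m \<in> Range E \<inter> Domain E" "n \<in> rel_ker E" for m n
    using linear_relation_add[OF E, of m m n 0] refl that by (simp add: rel_ker_def)
  then show "rel_P (Range E \<inter> Domain E) (rel_ker E) \<subseteq> E" unfolding rel_P_def by blast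
qed

text \<open>An element \<open>y\<close> of either side lies in both range and domain, so
  \<open>(y, y)\<close> is in \<open>E\<close>; subtracting \<open>(0, y)\<close> or
  \<open>(y, 0)\<close> from it exchanges membership in \<open>rel_mul E\<close> for membership in
  \<open>rel_ker E\<close>.\<close>

lemma rel_mul_Int_Domain_eq:
  assumes E: "linear_relation E" and refl: "\<forall>x \<in> Range E \<inter> Domain E. (x, x) \<in> E"
  shows "rel_mul E \<inter> Domain E = Range E \<inter> rel_ker E"
proof (intro equalityI subsetI)
  fix y assume "y \<in> rel_mul E \<inter> Domain E"
  then have y: "(0, y) \<in> E" "y \<in> Domain E" by (auto simp: rel_mul_def)
  then have "(y, y) \<in> E" using refl by blast
  then have "(y, 0) \<in> E" using linear_relation_diff[OF E _ y(1)] by fastforce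
  with y show "y \<in> Range E \<inter> rel_ker E" by (auto simp: rel_ker_def)
next
  fix y assume "y \<in> Range E \<inter> rel_ker E"
  then have y: "(y, 0) \<in> E" "y \<in> Range E" by (auto simp: rel_ker_def)
  then have "(y, y) \<in> E" using refl by blast
  then have "(0, y) \<in> E" using linear_relation_diff[OF E _ y(1)] by fastforce
  with y show "y \<in> rel_mul E \<inter> Domain E" by (auto simp: rel_mul_def)
qed

theorem proposition3p10:
  fixes E :: "('h::complex_hilbert_space \<times> 'h) set"
  assumes "separable_space (euclidean :: 'h topology)"
    and "linear_relation E"
  shows "(sub_idempotent E \<longleftrightarrow>
            E = rel_P (Range E) (Range (id_minus E)) \<inter> (Domain E \<times> UNIV)) \<and>
         (sub_idempotent E \<longleftrightarrow> rel_ker (id_minus E) = Range E \<inter> Domain E) \<and>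
         (sub_idempotent E \<longleftrightarrow> rel_P (Range E \<inter> Domain E) (rel_ker E) \<subseteq> E) \<and>
         (sub_idempotent E \<longrightarrow> rel_mul E \<inter> Domain E = Range E \<inter> rel_ker E)"
proof -
  note E = assms(2)
  \<comment> \<open>Any \<open>x\<close> with \<open>(x, x)\<close> in \<open>E\<close> lies in both
    range and domain, so the content of the equality is the reverse inclusion.\<close>
  have "rel_ker (id_minus E) = Range E \<inter> Domain E \<longleftrightarrow>
      (\<forall>x \<in> Range E \<inter> Domain E. (x, x) \<in> E)"
    unfolding rel_ker_id_minus by blast
  then show ?thesis
    using sub_idempotent_iff_refl_on_Range_Int_Domain[OF E]
      eq_rel_P_iff_refl_on_Range_Int_Domain[OF E]
      rel_P_subset_iff_refl_on_Range_Int_Domain[OF E] rel_mul_Int_Domain_eq[OF E]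
    by argo
qed

end
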